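(* Let $k$ be an algebraically closed field of characteristic zero, $n$ a positive integer, and let $T_n$ be the Lie algebra of all $n\times n$ upper triangular matrices with coefficients in $k$. Put $q=[n/2]$ and let $P$ be the linear span of the matrix units $E_{ij}$ with $1\le i\le q$ and $q+1\le j\le n$. Then $\alpha(T_n)=[n^2/4]+1=\alpha(\mathfrak{gl}(n,k))$, and $kI_n\oplus P$ is an abelian subalgebra of maximum dimension of both $T_n$ and $\mathfrak{gl}(n,k)$.
   Context: $[r]$ denotes the greatest integer $\le r$; $I_n$ is the identity matrix. $\alpha(L)$ denotes the maximum dimension of an abelian subalgebra of a finite dimensional Lie algebra $L$. *)

theory Defs
  imports "Jordan_Normal_Form.VS_Connect"
begin

record ('a, 'b) lie_algebra = "('a, 'b) module" +
  lie_bracket :: "'b \<Rightarrow> 'b \<Rightarrow> 'b"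

locale lie_algebra = vectorspace K L
  for K :: "('a, 'c) ring_scheme" and L :: "('a, 'b, 'd) lie_algebra_scheme" (structure) +
  assumes bracket_closed:
      "\<lbrakk>x \<in> carrier L; y \<in> carrier L\<rbrakk> \<Longrightarrow> lie_bracket L x y \<in> carrier L"
    and bracket_add_left:
      "\<lbrakk>x \<in> carrier L; y \<in> carrier L; z \<in> carrier L\<rbrakk> \<Longrightarrow>
        lie_bracket L (x \<oplus> y) z = lie_bracket L x z \<oplus> lie_bracket L y z"
    and bracket_add_right:
      "\<lbrakk>x \<in> carrier L; y \<in> carrier L; z \<in> carrier L\<rbrakk> \<Longrightarrow>
        lie_bracket L x (y \<oplus> z) = lie_bracket L x y \<oplus> lie_bracket L x z"
    and bracket_smult_left:
      "\<lbrakk>c \<in> carrier K; x \<in> carrier L; y \<in> carrier L\<rbrakk> \<Longrightarrow>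
        lie_bracket L (c \<odot> x) y = c \<odot> lie_bracket L x y"
    and bracket_smult_right:
      "\<lbrakk>c \<in> carrier K; x \<in> carrier L; y \<in> carrier L\<rbrakk> \<Longrightarrow>
        lie_bracket L x (c \<odot> y) = c \<odot> lie_bracket L x y"
    and bracket_self: "x \<in> carrier L \<Longrightarrow> lie_bracket L x x = \<zero>"
    and jacobi:
      "\<lbrakk>x \<in> carrier L; y \<in> carrier L; z \<in> carrier L\<rbrakk> \<Longrightarrow>
        lie_bracket L x (lie_bracket L y z) \<oplus>
        (lie_bracket L y (lie_bracket L z x) \<oplus>
         lie_bracket L z (lie_bracket L x y)) = \<zero>"

definition lie_subalgebra ::
    "('a, 'c) ring_scheme \<Rightarrow> 'b set \<Rightarrow> ('a, 'b, 'd) lie_algebra_scheme \<Rightarrow> bool" where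
  "lie_subalgebra K S L \<longleftrightarrow>
     VectorSpace.subspace K S L \<and> (\<forall>x\<in>S. \<forall>y\<in>S. lie_bracket L x y \<in> S)"

definition abelian_subalgebra ::
    "('a, 'c) ring_scheme \<Rightarrow> 'b set \<Rightarrow> ('a, 'b, 'd) lie_algebra_scheme \<Rightarrow> bool" where
  "abelian_subalgebra K S L \<longleftrightarrow>
     lie_subalgebra K S L \<and> (\<forall>x\<in>S. \<forall>y\<in>S. lie_bracket L x y = \<zero>\<^bsub>L\<^esub>)"

definition subspace_dim ::
    "('a, 'c) ring_scheme \<Rightarrow> 'b set \<Rightarrow> ('a, 'b, 'd) lie_algebra_scheme \<Rightarrow> nat" where
  "subspace_dim K S L = vectorspace.dim K (L\<lparr>carrier := S\<rparr>)"

text \<open>The maximum is meaningful only for finite-dimensional \<open>L\<close>, where the set of dimensions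
  is finite, and nonempty because of the zero subalgebra.\<close>

definition alpha :: "('a, 'c) ring_scheme \<Rightarrow> ('a, 'b, 'd) lie_algebra_scheme \<Rightarrow> nat" where
  "alpha K L = Max {subspace_dim K S L | S. abelian_subalgebra K S L}"

definition max_dim_abelian_subalgebra ::
    "('a, 'c) ring_scheme \<Rightarrow> 'b set \<Rightarrow> ('a, 'b, 'd) lie_algebra_scheme \<Rightarrow> bool" where
  "max_dim_abelian_subalgebra K A L \<longleftrightarrow>
     abelian_subalgebra K A L \<and>
     (\<forall>B. abelian_subalgebra K B L \<longrightarrow> subspace_dim K B L \<le> subspace_dim K A L)"

definition gl :: "'a::field itself \<Rightarrow> nat \<Rightarrow> ('a, 'a mat) lie_algebra" where
  "gl k n = module.extend (module_mat k n n)
     (lie_algebra.fields (\<lambda>A B. A * B - B * A))"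

definition upper_tri :: "'a::field itself \<Rightarrow> nat \<Rightarrow> ('a, 'a mat) lie_algebra" where
  "upper_tri k n = (gl k n)\<lparr>carrier := {A \<in> carrier_mat n n. upper_triangular A}\<rparr>"

definition matrix_unit :: "nat \<Rightarrow> nat \<Rightarrow> nat \<Rightarrow> 'a::field mat" where
  "matrix_unit n i j = mat n n (\<lambda>(r, c). if r = i \<and> c = j then 1 else 0)"

definition scalar_matrices :: "'a::field itself \<Rightarrow> nat \<Rightarrow> 'a mat set" where
  "scalar_matrices k n = {c \<cdot>\<^sub>m 1\<^sub>m n | c :: 'a. True}"

text \<open>Matrix indices start at 0, so with \<open>q = n div 2\<close> the 1-based range
  \<open>1 \<le> i \<le> q\<close>, \<open>q + 1 \<le> j \<le> n\<close> becomes \<open>i < q\<close>, \<open>q \<le> j < n\<close>.\<close>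

definition corner_block :: "'a::field itself \<Rightarrow> nat \<Rightarrow> 'a mat set" where
  "corner_block k n = LinearCombinations.module.span class_ring (gl k n)
     {matrix_unit n i j | i j. i < n div 2 \<and> n div 2 \<le> j \<and> j < n}"

lemma gl_simps [simp]:
  "carrier (gl k n) = carrier_mat n n"
  "mult (gl k n) = (*)"
  "one (gl k n) = 1\<^sub>m n"
  "zero (gl k n) = 0\<^sub>m n n"
  "add (gl k n) = (+)"
  "module.smult (gl k n) = (\<cdot>\<^sub>m)"
  "lie_bracket (gl k n) A B = A * B - B * A"
  by (simp_all add: gl_def module_mat_def module.defs lie_algebra.defs)

lemma upper_tri_simps [simp]:
  "carrier (upper_tri k n) = {A \<in> carrier_mat n n. upper_triangular A}"
  "mult (upper_tri k n) = (*)"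
  "one (upper_tri k n) = 1\<^sub>m n"
  "zero (upper_tri k n) = 0\<^sub>m n n"
  "add (upper_tri k n) = (+)"
  "module.smult (upper_tri k n) = (\<cdot>\<^sub>m)"
  "lie_bracket (upper_tri k n) A B = A * B - B * A"
  by (simp_all add: upper_tri_def)

lemma upper_triangular_add:
  assumes "A \<in> carrier_mat n n" "B \<in> carrier_mat n n" "upper_triangular A" "upper_triangular B"
  shows "upper_triangular (A + B :: 'a::field mat)"
  using assms by (intro upper_triangularI) (auto simp: upper_triangularD)

lemma upper_triangular_minus:
  assumes "A \<in> carrier_mat n n" "B \<in> carrier_mat n n" "upper_triangular A" "upper_triangular B"
  shows "upper_triangular (A - B :: 'a::field mat)"
  using assms by (intro upper_triangularI) (auto simp: upper_triangularD)

lemma upper_triangular_smult: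
  "upper_triangular A \<Longrightarrow> upper_triangular (c \<cdot>\<^sub>m A :: 'a::field mat)"
  if "A \<in> carrier_mat n n"
  using that by (intro upper_triangularI) (auto simp: upper_triangularD)

lemma upper_triangular_mult:
  fixes A B :: "'a::field mat"
  assumes "A \<in> carrier_mat n n" "B \<in> carrier_mat n n" "upper_triangular A" "upper_triangular B"
  shows "upper_triangular (A * B)"
proof (intro upper_triangularI)
  fix i j assume ij: "j < i" "i < dim_row (A * B)"
  have "A $$ (i,l) * B $$ (l,j) = 0" if "l < n" for l
    using ij assms that by (cases "l < i") (auto simp: upper_triangularD)
  then show "(A * B) $$ (i,j) = 0"
    using ij assms by (auto simp: scalar_prod_def intro!: sum.neutral)
qed

lemma vectorspace_gl: "vectorspace class_ring (gl (k :: 'a::field itself) n)"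
proof -
  have "abelian_group (gl k n)"
    by (unfold_locales, insert add_inv_exists_mat) (auto simp: Units_def)
  moreover have "module_axioms class_ring (gl k n)"
    by unfold_locales (auto simp: add_smult_distrib_right_mat add_smult_distrib_left_mat)
  ultimately show ?thesis
    by (intro vectorspace.intro Module.module.intro class_field class_cring.is_cring)
qed

lemma subspace_upper_tri:
  "VectorSpace.subspace class_ring {A \<in> carrier_mat n n. upper_triangular A}
     (gl (k :: 'a::field itself) n)"
  unfolding VectorSpace.subspace_def submodule_def
  using vectorspace_gl[of k n] vectorspace.axioms(1)[OF vectorspace_gl[of k n]]
  by (auto intro!: upper_triangular_add upper_triangular_smult)

lemma vectorspace_upper_tri: "vectorspace class_ring (upper_tri (k :: 'a::field itself) n)"
  using vectorspace.subspace_is_vs[OF vectorspace_gl subspace_upper_tri]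
  by (simp add: upper_tri_def)

lemma commutator_identities:
  fixes A B C :: "'a::field mat"
  assumes [simp]: "A \<in> carrier_mat n n" "B \<in> carrier_mat n n" "C \<in> carrier_mat n n"
  shows "(A + B) * C - C * (A + B) = (A * C - C * A) + (B * C - C * B)"
    and "C * (A + B) - (A + B) * C = (C * A - A * C) + (C * B - B * C)"
    and "(c \<cdot>\<^sub>m A) * B - B * (c \<cdot>\<^sub>m A) = c \<cdot>\<^sub>m (A * B - B * A)"
    and "A * (c \<cdot>\<^sub>m B) - (c \<cdot>\<^sub>m B) * A = c \<cdot>\<^sub>m (A * B - B * A)"
    and "(A * (B * C - C * B) - (B * C - C * B) * A) +
         ((B * (C * A - A * C) - (C * A - A * C) * B) +
          (C * (A * B - B * A) - (A * B - B * A) * C)) = 0\<^sub>m n n"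
proof -
  have cl: "X * Y \<in> carrier_mat n n" if "X \<in> carrier_mat n n" "Y \<in> carrier_mat n n" for X Y :: "'a mat"
    using that by simp
  have add: "(P + Q) - (R + S) = (P - R) + (Q - S)"
    if "P \<in> carrier_mat n n" "Q \<in> carrier_mat n n" "R \<in> carrier_mat n n" "S \<in> carrier_mat n n"
    for P Q R S :: "'a mat"
    using that by (intro eq_matI) auto
  have smult: "c \<cdot>\<^sub>m P - c \<cdot>\<^sub>m Q = c \<cdot>\<^sub>m (P - Q)"
    if "P \<in> carrier_mat n n" "Q \<in> carrier_mat n n" for P Q :: "'a mat"
    using that by (intro eq_matI) (auto simp: algebra_simps)
  have six: "((P - Q) - (R - S)) + (((R - T) - (U - Q)) + ((U - S) - (P - T))) = 0\<^sub>m n n"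
    if "P \<in> carrier_mat n n" "Q \<in> carrier_mat n n" "R \<in> carrier_mat n n" "S \<in> carrier_mat n n"
      "T \<in> carrier_mat n n" "U \<in> carrier_mat n n" for P Q R S T U :: "'a mat"
    using that by (intro eq_matI) auto
  show "(A + B) * C - C * (A + B) = (A * C - C * A) + (B * C - C * B)"
    by (simp add: add_mult_distrib_mat[where nr=n and nc=n and n=n] mult_add_distrib_mat[where nr=n and nc=n and n=n] add cl)
  show "C * (A + B) - (A + B) * C = (C * A - A * C) + (C * B - B * C)"
    by (simp add: add_mult_distrib_mat[where nr=n and nc=n and n=n] mult_add_distrib_mat[where nr=n and nc=n and n=n] add cl)
  show "(c \<cdot>\<^sub>m A) * B - B * (c \<cdot>\<^sub>m A) = c \<cdot>\<^sub>m (A * B - B * A)"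
    by (simp add: mult_smult_assoc_mat[where nr=n and nc=n and n=n] mult_smult_distrib[where nr=n and nc=n and n=n] smult cl)
  show "A * (c \<cdot>\<^sub>m B) - (c \<cdot>\<^sub>m B) * A = c \<cdot>\<^sub>m (A * B - B * A)"
    by (simp add: mult_smult_assoc_mat[where nr=n and nc=n and n=n] mult_smult_distrib[where nr=n and nc=n and n=n] smult cl)
  have expand:
    "X * (Y * Z - Z * Y) - (Y * Z - Z * Y) * X
       = (X * (Y * Z) - X * (Z * Y)) - (Y * (Z * X) - Z * (Y * X))"
    if "X \<in> carrier_mat n n" "Y \<in> carrier_mat n n" "Z \<in> carrier_mat n n" for X Y Z :: "'a mat"
    using that
    by (simp add: mult_minus_distrib_mat[where nr=n and nc=n and n=n] minus_mult_distrib_mat[where nr=n and nc=n and n=n]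
        assoc_mult_mat[of _ n n _ n _ n] cl)
  show "(A * (B * C - C * B) - (B * C - C * B) * A) +
         ((B * (C * A - A * C) - (C * A - A * C) * B) +
          (C * (A * B - B * A) - (A * B - B * A) * C)) = 0\<^sub>m n n"
    unfolding expand[OF assms(1,2,3)] expand[OF assms(2,3,1)] expand[OF assms(3,1,2)]
    by (intro six cl assms)
qed

lemma lie_algebra_gl: "lie_algebra class_ring (gl (k :: 'a::field itself) n)"
  by (intro lie_algebra.intro vectorspace_gl lie_algebra_axioms.intro)
    (auto simp: commutator_identities)

lemma lie_subalgebra_upper_tri:
  "lie_subalgebra class_ring {A \<in> carrier_mat n n. upper_triangular A}
     (gl (k :: 'a::field itself) n)"
  unfolding lie_subalgebra_def
  using subspace_upper_tri[of n k]
  by (auto intro!: upper_triangular_minus upper_triangular_mult)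

lemma lie_algebra_upper_tri: "lie_algebra class_ring (upper_tri (k :: 'a::field itself) n)"
  by (intro lie_algebra.intro vectorspace_upper_tri lie_algebra_axioms.intro)
    (auto simp: commutator_identities intro!: upper_triangular_minus upper_triangular_mult)

end

theory Submission
  imports Defs "Jordan_Normal_Form.Schur_Decomposition" "Jordan_Normal_Form.DL_Rank"
begin

text \<open>
  The heart of the matter is Schur's bound: a linear space \<open>S\<close> of pairwise commuting
  \<open>n \<times> n\<close> matrices has dimension at most \<open>\<lfloor>n\<^sup>2/4\<rfloor> + 1\<close>. The argument is a variant of
  Mirzakhani's short proof in which dimensions are replaced by determining sets of entries: if every
  matrix of \<open>S\<close> that vanishes at the positions in \<open>J\<close> is zero, then \<open>dim S \<le> |J|\<close>
  (\<open>subspace_dim_le_card\<close>).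

  Over an algebraically closed field the matrices of \<open>S\<close> can be made upper triangular by one change
  of basis (\<open>commuting_subspace_triangularizable\<close>), so one may look for a determining set of a
  commuting family of upper triangular matrices, and it is found by induction on the size \<open>m\<close> of a
  diagonal block (\<open>commuting_upper_tri_determined\<close>). Passing from a block of size \<open>m\<close> to one of size
  \<open>m + 1\<close> can be done in two ways. Either a row is added on top; then the matrices not yet
  determined live in this row, and it suffices to add the set \<open>L\<close> of the columns in which such a row
  has its first nonzero entry. Or a column is added on the right; then it suffices to add the set
  \<open>T\<close> of the rows in which such a column has its last nonzero entry. If \<open>A\<close> is a matrix of the first
  kind, with leading position \<open>i\<close>, and \<open>B\<close> one of the second kind, with trailing position \<open>i\<close> as well,
  then the top right entry of \<open>AB\<close> on the block is the product of these two nonzero entries, whereas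
  that of \<open>BA\<close> is zero. Hence \<open>L\<close> and \<open>T\<close> are disjoint subsets of a set of \<open>m + 1\<close> elements, and one
  of them has at most \<open>\<lfloor>(m + 1)/2\<rfloor>\<close> elements. This is precisely the difference
  \<open>\<lfloor>(m + 1)\<^sup>2/4\<rfloor> - \<lfloor>m\<^sup>2/4\<rfloor>\<close>.

  Conversely, products of two elements of the corner block \<open>P\<close> vanish, so \<open>kI + P\<close> is a commuting
  space of upper triangular matrices; it has \<open>1 + q(n - q) = \<lfloor>n\<^sup>2/4\<rfloor> + 1\<close> free parameters
  (\<open>scalar_corner_sum_dim_ge\<close>). It lies in both algebras, so the bound is attained in both.
\<close>

section \<open>Dimension bounds from injective linear maps\<close>

text \<open>The codomain bounds the size of the independent sets of the domain, because an
  injective linear map preserves independence; a maximal independent set is then a finite basis.\<close>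

lemma (in linear_map) inj_imp_dim_le:
  assumes inj: "inj_on T (carrier V)" and fin: "W.fin_dim"
  shows "V.fin_dim" and "V.dim \<le> W.dim"
proof -
  have bound: "finite B \<and> card B \<le> W.dim"
    if B: "B \<subseteq> carrier V \<and> V.module.lin_indpt B" for B
  proof -
    have small: "card C \<le> W.dim" if C: "C \<subseteq> B" "finite C" for C
    proof -
      have CV: "C \<subseteq> carrier V" and liC: "V.module.lin_indpt C"
        using B C V.module.subset_li_is_li by blast+
      have "W.module.lin_indpt (T ` C)"
      proof (rule W.module.finite_lin_indpt2)
        show "finite (T ` C)" "T ` C \<subseteq> carrier W" using C CV by auto
        fix a assume a: "a \<in> T ` C \<rightarrow> carrier K" and "W.module.lincomb a (T ` C) = \<zero>\<^bsub>W\<^esub>"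
        then have "T (V.module.lincomb (a \<circ> T) C) = T \<zero>\<^bsub>V\<^esub>"
          using lincomb_linear_image[OF inj CV a C(2)] by simp
        moreover have aT: "a \<circ> T \<in> C \<rightarrow> carrier K" using a by auto
        ultimately have "V.module.lincomb (a \<circ> T) C = \<zero>\<^bsub>V\<^esub>"
          using inj_onD[OF inj _ V.module.lincomb_closed[OF CV] V.module.M.zero_closed] by blast
        then show "\<forall>v\<in>T ` C. a v = \<zero>\<^bsub>K\<^esub>"
          using V.not_lindepD[OF liC C(2) order_refl aT] by (simp add: Pi_iff)
      qed
      moreover have "T ` C \<subseteq> carrier W" using CV T_im by blast
      ultimately have "card (T ` C) \<le> W.dim" by (intro W.li_le_dim(2)[OF fin])
      moreover have "card (T ` C) = card C" by (rule card_image, rule inj_on_subset[OF inj CV])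
      ultimately show ?thesis by simp
    qed
    have "finite B"
    proof (rule ccontr)
      assume "infinite B"
      then obtain C where "C \<subseteq> B" "finite C" "card C = Suc W.dim"
        using infinite_arbitrarily_large by metis
      then show False using small[of C] by simp
    qed
    then show ?thesis using small[OF order_refl] by simp
  qed
  have "{} \<subseteq> carrier V \<and> V.module.lin_indpt {}" by (simp add: V.module.lin_dep_def)
  then obtain B where B: "finite B" "maximal B (\<lambda>S. S \<subseteq> carrier V \<and> V.module.lin_indpt S)"
    using maximal_exists[of "\<lambda>S. S \<subseteq> carrier V \<and> V.module.lin_indpt S" "W.dim"] bound by blast
  then have basis: "V.basis B" by (intro V.max_li_is_basis)
  then show "V.fin_dim" using B(1) unfolding V.fin_dim_def V.basis_def by blast
  have "card B \<le> W.dim" using bound[of B] basis unfolding V.basis_def by blast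
  then show "V.dim \<le> W.dim" using V.dim_basis[OF B(1) basis] by simp
qed

text \<open>The functionals \<open>\<phi> p\<close> with \<open>p \<in> J\<close> are the components of an injective linear map
  from \<open>S\<close> to the column vectors of length \<open>card J\<close>. They may be any linear functionals of
  matrices, so that entries can be read off after a change of basis.\<close>

lemma subspace_dim_le_card:
  fixes k :: "'a::field itself" and \<phi> :: "'j \<Rightarrow> 'a mat \<Rightarrow> 'a"
  assumes S: "VectorSpace.subspace class_ring S (gl k n)" and J: "finite J"
    and add: "\<And>p A B. p \<in> J \<Longrightarrow> A \<in> carrier_mat n n \<Longrightarrow> B \<in> carrier_mat n n \<Longrightarrow> \<phi> p (A + B) = \<phi> p A + \<phi> p B"
    and smult: "\<And>p c A. p \<in> J \<Longrightarrow> A \<in> carrier_mat n n \<Longrightarrow> \<phi> p (c \<cdot>\<^sub>m A) = c * \<phi> p A"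
    and determined: "\<And>A. A \<in> S \<Longrightarrow> (\<And>p. p \<in> J \<Longrightarrow> \<phi> p A = 0) \<Longrightarrow> A = 0\<^sub>m n n"
  shows "vectorspace.fin_dim class_ring ((gl k n)\<lparr>carrier := S\<rparr>)"
    and "subspace_dim class_ring S (gl k n) \<le> card J"
proof -
  obtain h where h: "bij_betw h {0..<card J} J"
    using J ex_bij_betw_nat_finite by blast
  define T where "T A = vec (card J) (\<lambda>l. \<phi> (h l) A)" for A
  let ?V = "(gl k n)\<lparr>carrier := S\<rparr>"
  let ?W = "module_vec TYPE('a) (card J)"
  have hJ: "h l \<in> J" if "l < card J" for l using h that by (auto simp: bij_betw_def)
  have sub: "S \<subseteq> carrier_mat n n"
    using S by (auto simp: VectorSpace.subspace_def submodule_def)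
  interpret gl: vectorspace class_ring "gl k n" by (rule vectorspace_gl)
  interpret V: vectorspace class_ring ?V by (rule gl.subspace_is_vs[OF S])
  interpret W: vectorspace class_ring ?W by (rule vec_vs)
  have "T \<in> LinearCombinations.module_hom class_ring ?V ?W"
    unfolding LinearCombinations.module_hom_def using sub hJ
    by (auto simp: T_def module_vec_simps add smult subset_iff intro!: eq_vecI)
  then interpret T: linear_map class_ring ?V ?W T
    by unfold_locales
  have "carrier (?V\<lparr>carrier := T.ker\<rparr>) = {\<zero>\<^bsub>?V\<^esub>}"
  proof -
    have "A = 0\<^sub>m n n" if "A \<in> S" "T A = 0\<^sub>v (card J)" for A
    proof (rule determined[OF that(1)])
      fix p assume "p \<in> J"
      then have "p \<in> h ` {0..<card J}" using bij_betw_imp_surj_on[OF h] by simp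
      then obtain l where "l < card J" "p = h l" by (elim imageE) simp
      then show "\<phi> p A = 0" using arg_cong[OF that(2), of "\<lambda>v. v $ l"] unfolding T_def by simp
    qed
    moreover have "0\<^sub>m n n \<in> S"
      using submodule.zero_closed[OF VectorSpace.subspace.submod[OF S]] by simp
    moreover have "T (0\<^sub>m n n) = 0\<^sub>v (card J)"
    proof -
      have "0 \<cdot>\<^sub>m 0\<^sub>m n n = (0\<^sub>m n n :: 'a mat)" by (intro eq_matI) auto
      then have "\<phi> p (0\<^sub>m n n) = 0" if "p \<in> J" for p
        using smult[OF that zero_carrier_mat, of 0] by simp
      then show ?thesis using hJ by (intro eq_vecI) (auto simp: T_def)
    qed
    ultimately have "{A \<in> S. T A = 0\<^sub>v (card J)} = {0\<^sub>m n n}" by blast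
    then show ?thesis by (simp add: T.ker_def module_vec_simps)
  qed
  then have inj: "inj_on T (carrier ?V)" by (rule T.Ke0_imp_inj)
  show "V.fin_dim" by (rule T.inj_imp_dim_le(1)[OF inj vec_space.fin_dim])
  show "subspace_dim class_ring S (gl k n) \<le> card J"
    using T.inj_imp_dim_le(2)[OF inj vec_space.fin_dim]
    by (simp add: subspace_dim_def vec_space.dim_is_n)
qed

section \<open>Determining positions of commuting upper triangular matrices\<close>

definition commuting :: "'a::semiring_0 mat set \<Rightarrow> bool" where
  "commuting F \<longleftrightarrow> (\<forall>A\<in>F. \<forall>B\<in>F. A * B = B * A)"

lemma square_quarter_Suc: "(Suc m)\<^sup>2 div 4 = m\<^sup>2 div 4 + Suc m div 2"
proof (cases "even m")
  case True
  then obtain l where "m = 2 * l" by auto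
  then have "m\<^sup>2 = 4 * (l * l)" "(Suc m)\<^sup>2 = 4 * (l * l + l) + 1" "Suc m div 2 = l"
    by (auto simp: power2_eq_square algebra_simps)
  then show ?thesis by simp
next
  case False
  then obtain l where "m = 2 * l + 1" by (auto elim: oddE)
  then have "m\<^sup>2 = 4 * (l * l + l) + 1" "(Suc m)\<^sup>2 = 4 * (l * l + 2 * l + 1)" "Suc m div 2 = l + 1"
    by (auto simp: power2_eq_square algebra_simps)
  then show ?thesis by simp
qed

definition vanishes_on_block :: "nat \<Rightarrow> nat \<Rightarrow> 'a::zero mat \<Rightarrow> bool" where
  "vanishes_on_block a b A \<longleftrightarrow> (\<forall>i\<in>{a..<b}. \<forall>j\<in>{a..<b}. A $$ (i, j) = 0)"

text \<open>The summation range only meets the rows and columns between \<open>i\<close> and \<open>j\<close>: diagonal blocks of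
  upper triangular matrices multiply among themselves.\<close>

lemma upper_tri_mult_index:
  fixes A B :: "'a::semiring_0 mat"
  assumes "A \<in> carrier_mat n n" "B \<in> carrier_mat n n" "upper_triangular A" "upper_triangular B"
    and "i < n" "j < n"
  shows "(A * B) $$ (i, j) = (\<Sum>l\<in>{i..j}. A $$ (i, l) * B $$ (l, j))"
proof -
  have "(A * B) $$ (i, j) = (\<Sum>l\<in>{0..<n}. A $$ (i, l) * B $$ (l, j))"
    using assms by (simp add: scalar_prod_def)
  also have "\<dots> = (\<Sum>l\<in>{i..j}. A $$ (i, l) * B $$ (l, j))"
    using assms by (intro sum.mono_neutral_right) (auto simp: upper_triangularD)
  finally show ?thesis .
qed

text \<open>Schur's bound in a form free of dimensions. \<open>W\<close> is an arbitrary commuting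
  set, and the block moves inside fixed \<open>n \<times> n\<close> matrices, so the induction never has to pass to
  smaller matrices. The two cases at the end extend the block upwards and to the left, or downwards and to
  the right, whichever costs fewer positions.\<close>

lemma commuting_upper_tri_determined:
  fixes W :: "'a::field mat set"
  assumes W: "W \<subseteq> carrier_mat n n" and ut: "\<And>A. A \<in> W \<Longrightarrow> upper_triangular A"
    and comm: "commuting W" and "a + m \<le> n"
  shows "\<exists>J \<subseteq> {a..<a + m} \<times> {a..<a + m}. card J \<le> m\<^sup>2 div 4 + 1 \<and>
    (\<forall>A\<in>W. (\<forall>p\<in>J. A $$ p = 0) \<longrightarrow> vanishes_on_block a (a + m) A)"
  using \<open>a + m \<le> n\<close>
proof (induction m arbitrary: a)
  case 0
  show ?case by (intro exI[of _ "{}"]) (simp add: vanishes_on_block_def)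
next
  case (Suc m)
  define b where "b = a + m"
  show ?case
  proof (cases "m = 0")
    case True
    then show ?thesis
      by (intro exI[of _ "{(a, a)}"]) (auto simp: vanishes_on_block_def)
  next
    case False
    \<comment> \<open>Leading positions of the matrices supported on the first row of the block, and
      trailing positions of those supported on its last column.\<close>
    define L where "L = {j \<in> {a..b}. \<exists>A\<in>W. vanishes_on_block (Suc a) (Suc b) A \<and>
      A $$ (a, j) \<noteq> 0 \<and> (\<forall>l\<in>{a..<j}. A $$ (a, l) = 0)}"
    define T where "T = {i \<in> {a..b}. \<exists>A\<in>W. vanishes_on_block a b A \<and>
      A $$ (i, b) \<noteq> 0 \<and> (\<forall>l\<in>{i<..b}. A $$ (l, b) = 0)}"
    have fin: "finite L" "finite T" by (auto simp: L_def T_def)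
    have "L \<inter> T = {}"
    proof (rule ccontr)
      assume "L \<inter> T \<noteq> {}"
      then obtain i A B where i: "i \<in> {a..b}" and AW: "A \<in> W" "B \<in> W"
        and A: "vanishes_on_block (Suc a) (Suc b) A" "A $$ (a, i) \<noteq> 0"
          "\<And>l. l \<in> {a..<i} \<Longrightarrow> A $$ (a, l) = 0"
        and B: "vanishes_on_block a b B" "B $$ (i, b) \<noteq> 0"
          "\<And>l. l \<in> {i<..b} \<Longrightarrow> B $$ (l, b) = 0"
        unfolding L_def T_def by blast
      have ab: "a < b" "b < n" using False Suc.prems by (auto simp: b_def)
      have mult: "(X * Y) $$ (a, b) = (\<Sum>l\<in>{a..b}. X $$ (a, l) * Y $$ (l, b))"
        if "X \<in> W" "Y \<in> W" for X Y
        using that W ut ab by (intro upper_tri_mult_index) auto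
      \<comment> \<open>To the left of \<open>i\<close> the row of \<open>A\<close> vanishes, and below \<open>i\<close> the column of \<open>B\<close> does.\<close>
      have "(A * B) $$ (a, b) = (\<Sum>l\<in>{i}. A $$ (a, l) * B $$ (l, b))"
        unfolding mult[OF AW]
      proof (rule sum.mono_neutral_right)
        show "\<forall>l\<in>{a..b} - {i}. A $$ (a, l) * B $$ (l, b) = 0"
        proof
          fix l assume "l \<in> {a..b} - {i}"
          then have "l \<in> {a..<i} \<or> l \<in> {i<..b}" by auto
          then show "A $$ (a, l) * B $$ (l, b) = 0" using A(3) B(3) by auto
        qed
      qed (use i in auto)
      \<comment> \<open>The row of \<open>B\<close> vanishes before column \<open>b\<close>, and the corner entry \<open>(b, b)\<close> of \<open>A\<close> is zero;
        this needs \<open>a < b\<close>, whence the separate treatment of blocks of size one.\<close>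
      moreover have "(B * A) $$ (a, b) = 0"
        unfolding mult[OF AW(2,1)]
      proof (intro sum.neutral ballI)
        fix l assume l: "l \<in> {a..b}"
        show "B $$ (a, l) * A $$ (l, b) = 0"
          using l A(1) B(1) ab by (cases "l = b") (auto simp: vanishes_on_block_def)
      qed
      moreover have "A * B = B * A" using comm AW by (auto simp: commuting_def)
      ultimately show False using A(2) B(2) by simp
    qed
    then have "card L + card T = card (L \<union> T)" using fin by (simp add: card_Un_disjoint)
    also have "\<dots> \<le> card {a..b}" by (rule card_mono) (auto simp: L_def T_def)
    finally have "card L + card T \<le> Suc m" by (simp add: b_def)
    then consider "card L \<le> Suc m div 2" | "card T \<le> Suc m div 2" by linarith
    then show ?thesis
    proof cases
      case 1
      have "Suc a + m \<le> n" using Suc.prems by simp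
      from Suc.IH[OF this] obtain J where J: "J \<subseteq> {Suc a..b} \<times> {Suc a..b}" "card J \<le> m\<^sup>2 div 4 + 1"
        and det: "\<And>A. A \<in> W \<Longrightarrow> \<forall>p\<in>J. A $$ p = 0 \<Longrightarrow> vanishes_on_block (Suc a) (Suc b) A"
        by (auto simp: b_def atLeastLessThanSuc_atLeastAtMost)
      let ?J = "J \<union> Pair a ` L"
      have "card ?J \<le> card J + card L"
        using card_Un_le[of J "Pair a ` L"] card_image_le[OF fin(1), of "Pair a"] by linarith
      then have "card ?J \<le> (Suc m)\<^sup>2 div 4 + 1" using 1 J(2) square_quarter_Suc[of m] by linarith
      moreover have "vanishes_on_block a (Suc b) A" if A: "A \<in> W" "\<forall>p\<in>?J. A $$ p = 0" for A
      proof -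
        have blk: "vanishes_on_block (Suc a) (Suc b) A" using det A by auto
        have row: "A $$ (a, j) = 0" if "j \<in> {a..b}" for j
          using that
        proof (induction j rule: less_induct)
          case (less j)
          then have "\<forall>l\<in>{a..<j}. A $$ (a, l) = 0" by auto
          then have "A $$ (a, j) \<noteq> 0 \<Longrightarrow> j \<in> L" using less.prems blk A(1) by (auto simp: L_def)
          then show ?case using A(2) by auto
        qed
        have "A $$ (i, a) = 0" if "i \<in> {a<..b}" for i
          using that upper_triangularD[OF ut[OF A(1)], of a i] A(1) W Suc.prems
          by (auto simp: b_def)
        with blk row show ?thesis
          unfolding vanishes_on_block_def
          by (metis Suc_leI atLeastLessThan_iff atLeastAtMost_iff greaterThanAtMost_iff le_neq_implies_less less_Suc_eq_le)
      qed
      ultimately show ?thesis using J(1) by (intro exI[of _ ?J]) (auto simp: b_def L_def T_def)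
    next
      case 2
      have "a + m \<le> n" using Suc.prems by simp
      from Suc.IH[OF this] obtain J where J: "J \<subseteq> {a..<b} \<times> {a..<b}" "card J \<le> m\<^sup>2 div 4 + 1"
        and det: "\<And>A. A \<in> W \<Longrightarrow> \<forall>p\<in>J. A $$ p = 0 \<Longrightarrow> vanishes_on_block a b A"
        by (auto simp: b_def atLeastLessThanSuc_atLeastAtMost)
      let ?J = "J \<union> (\<lambda>i. (i, b)) ` T"
      have "card ?J \<le> card J + card T"
        using card_Un_le[of J "(\<lambda>i. (i, b)) ` T"] card_image_le[OF fin(2), of "\<lambda>i. (i, b)"] by linarith
      then have "card ?J \<le> (Suc m)\<^sup>2 div 4 + 1" using 2 J(2) square_quarter_Suc[of m] by linarith
      moreover have "vanishes_on_block a (Suc b) A" if A: "A \<in> W" "\<forall>p\<in>?J. A $$ p = 0" for A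
      proof -
        have blk: "vanishes_on_block a b A" using det A by auto
        have col: "A $$ (i, b) = 0" if "i \<in> {a..b}" for i
          using that
        proof (induction "b - i" arbitrary: i rule: less_induct)
          case less
          then have "\<forall>l\<in>{i<..b}. A $$ (l, b) = 0" by auto
          then have "A $$ (i, b) \<noteq> 0 \<Longrightarrow> i \<in> T" using less.prems blk A(1) by (auto simp: T_def)
          then show ?case using A(2) by auto
        qed
        have "A $$ (b, j) = 0" if "j \<in> {a..<b}" for j
          using that upper_triangularD[OF ut[OF A(1)], of j b] A(1) W Suc.prems
          by (auto simp: b_def)
        with blk col show ?thesis
          unfolding vanishes_on_block_def
          by (metis atLeastLessThan_iff atLeastAtMost_iff less_antisym less_Suc_eq_le)
      qed
      ultimately show ?thesis using J(1) by (intro exI[of _ ?J]) (auto simp: b_def L_def T_def)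
    qed
  qed
qed

section \<open>Simultaneous triangularization of commuting matrices\<close>

definition common_eigenvector :: "nat \<Rightarrow> 'a::comm_ring_1 mat set \<Rightarrow> 'a vec \<Rightarrow> bool" where
  "common_eigenvector n F v \<longleftrightarrow>
     v \<in> carrier_vec n \<and> v \<noteq> 0\<^sub>v n \<and> (\<forall>A\<in>F. \<exists>c. A *\<^sub>v v = c \<cdot>\<^sub>v v)"

definition simultaneously_triangularizable :: "nat \<Rightarrow> 'a::comm_ring_1 mat set \<Rightarrow> bool" where
  "simultaneously_triangularizable n F \<longleftrightarrow>
     (\<exists>P\<in>carrier_mat n n. \<exists>Q\<in>carrier_mat n n. P * Q = 1\<^sub>m n \<and> Q * P = 1\<^sub>m n \<and>
        (\<forall>A\<in>F. upper_triangular (Q * A * P)))"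

lemma alg_closed_eigenvector_exists:
  fixes A :: "'a::alg_closed_field mat"
  assumes A: "A \<in> carrier_mat n n" and "n > 0"
  shows "\<exists>v. common_eigenvector n {A} v"
proof -
  have "degree (char_poly A) > 0" using degree_monic_char_poly[OF A] \<open>n > 0\<close> by simp
  then obtain c where "poly (char_poly A) c = 0" using alg_closed_imp_poly_has_root by blast
  then have "eigenvalue A c" using eigenvalue_root_char_poly[OF A] by simp
  then show ?thesis
    using A unfolding eigenvalue_def eigenvector_def common_eigenvector_def by auto
qed

text \<open>Every nonzero vector can be completed to a basis, whose vectors are the columns of \<open>P\<close>.\<close>

lemma obtain_invertible_with_first_col:
  fixes v :: "'a::field vec"
  assumes v: "v \<in> carrier_vec n" "v \<noteq> 0\<^sub>v n"
  obtains P Q where "P \<in> carrier_mat n n" "Q \<in> carrier_mat n n"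
    "P * Q = 1\<^sub>m n" "Q * P = 1\<^sub>m n" "col P 0 = v"
proof -
  interpret vec_space "TYPE('a)" n .
  define bs where "bs = basis_completion v"
  note bs = basis_completion[OF v, folded bs_def]
  have "n > 0" using v by (cases n) auto
  define P where "P = mat_of_cols n bs"
  have P: "P \<in> carrier_mat n n" using bs(6) by (auto simp: P_def)
  have cols: "cols P = bs" using bs(2) by (simp add: P_def)
  then have "rank P = n" using lin_indpt_full_rank[OF P] bs(4,5) by simp
  then have "det P \<noteq> 0" using det_rank_iff[OF P] by simp
  from det_non_zero_imp_unit[OF P this, of "()"]
  obtain Q where Q: "Q \<in> carrier_mat n n" "Q * P = 1\<^sub>m n" "P * Q = 1\<^sub>m n"
    by (auto simp: Units_def ring_mat_def)
  have "col P 0 = hd bs" using cols bs(6) \<open>n > 0\<close> P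
    by (metis carrier_matD(2) cols_nth hd_conv_nth length_0_conv not_gr_zero)
  then show ?thesis using that[OF P Q(1,3,2)] bs(7) by simp
qed

text \<open>Deflation: in a basis that starts with a common eigenvector, all matrices have the shape
  \<open>(E R; 0 D)\<close> with \<open>E\<close> of size one, and the blocks \<open>D\<close> form a smaller commuting family. The bound
  \<open>k\<close> on the number of matrices is there because the lemma is used twice: with \<open>k = 1\<close>, where any
  eigenvector of a single matrix will do, and then for arbitrary finite families, whose common
  eigenvectors are constructed from triangular forms of single matrices.\<close>

lemma triangularizable_if_common_eigenvectors:
  fixes F :: "'a::field mat set"
  assumes eigen: "\<And>m G. \<lbrakk>m > 0; G \<subseteq> carrier_mat m m; finite G; card G \<le> k; commuting G\<rbrakk> \<Longrightarrow>
      \<exists>v :: 'a vec. common_eigenvector m G v"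
    and F: "F \<subseteq> carrier_mat n n" "finite F" "card F \<le> k" "commuting F"
  shows "simultaneously_triangularizable n F"
  using F
proof (induction n arbitrary: F)
  case 0
  then show ?case
    unfolding simultaneously_triangularizable_def
    by (intro bexI[of _ "1\<^sub>m 0"] conjI ballI upper_triangularI) auto
next
  case (Suc n)
  obtain v where v: "common_eigenvector (Suc n) F v" using eigen[of "Suc n" F] Suc.prems by auto
  then obtain P Q where P: "P \<in> carrier_mat (Suc n) (Suc n)" and Q: "Q \<in> carrier_mat (Suc n) (Suc n)"
    and PQ: "P * Q = 1\<^sub>m (Suc n)" "Q * P = 1\<^sub>m (Suc n)" and col: "col P 0 = v"
    using obtain_invertible_with_first_col unfolding common_eigenvector_def by metis
  define D where "D A = mat n n (\<lambda>(i, j). (Q * A * P) $$ (Suc i, Suc j))" for A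
  define R where "R A = mat 1 n (\<lambda>(i, j). (Q * A * P) $$ (0, Suc j))" for A
  define E where "E A = mat 1 1 (\<lambda>_. (Q * A * P) $$ (0, 0))" for A
  have DRE: "D A \<in> carrier_mat n n" "R A \<in> carrier_mat 1 n" "E A \<in> carrier_mat 1 1" for A
    by (auto simp: D_def R_def E_def)
  have block: "Q * A * P = four_block_mat (E A) (R A) (0\<^sub>m n 1) (D A)" if A: "A \<in> F" for A
  proof -
    have AC: "A \<in> carrier_mat (Suc n) (Suc n)" using A Suc.prems by auto
    obtain c where c: "A *\<^sub>v v = c \<cdot>\<^sub>v v" using v A by (auto simp: common_eigenvector_def)
    have vC: "v \<in> carrier_vec (Suc n)" using v by (auto simp: common_eigenvector_def)
    have colm: "col (X * P) 0 = X *\<^sub>v v" if "X \<in> carrier_mat (Suc n) (Suc n)" for X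
      using that P col by (auto intro!: eq_vecI)
    have "col (Q * A * P) 0 = Q * A *\<^sub>v v" using Q AC by (intro colm) auto
    also have "\<dots> = Q *\<^sub>v (c \<cdot>\<^sub>v v)" using Q AC vC c by (simp add: assoc_mult_mat_vec[of _ "Suc n" "Suc n" _ "Suc n"])
    also have "\<dots> = c \<cdot>\<^sub>v (Q *\<^sub>v v)" using Q vC by (simp add: mult_mat_vec)
    also have "Q *\<^sub>v v = col (1\<^sub>m (Suc n)) 0" using colm[OF Q] PQ by simp
    finally have "col (Q * A * P) 0 = c \<cdot>\<^sub>v unit_vec (Suc n) 0" by simp
    note col0 = this
    have zero: "(Q * A * P) $$ (Suc i, 0) = 0" if "i < n" for i
    proof -
      have "(Q * A * P) $$ (Suc i, 0) = col (Q * A * P) 0 $ Suc i"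
        using that P Q by (intro index_col[symmetric]) auto
      then show ?thesis using that unfolding col0 by simp
    qed
    show ?thesis
      using P Q AC zero
      by (intro eq_matI) (auto simp: D_def R_def E_def less_Suc_eq_0_disj not_less)
  qed
  have conj_mult: "Q * (A * B) * P = (Q * A * P) * (Q * B * P)"
    if "A \<in> carrier_mat (Suc n) (Suc n)" "B \<in> carrier_mat (Suc n) (Suc n)" for A B
  proof -
    have "(Q * A * P) * (Q * B * P) = Q * A * (P * Q) * B * P"
      using P Q that by (simp add: assoc_mult_mat[of _ "Suc n" "Suc n" _ "Suc n" _ "Suc n"] del: index_mult_mat)
    also have "\<dots> = Q * (A * B) * P"
      using P Q that PQ by (simp add: assoc_mult_mat[of _ "Suc n" "Suc n" _ "Suc n" _ "Suc n"])
    finally show ?thesis by simp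
  qed
  have block_mult: "four_block_mat a b (0\<^sub>m n 1) d * four_block_mat a' b' (0\<^sub>m n 1) d' =
      four_block_mat (a * a') (a * b' + b * d') (0\<^sub>m n 1) (d * d')"
    if "a \<in> carrier_mat 1 1" "b \<in> carrier_mat 1 n" "d \<in> carrier_mat n n"
      "a' \<in> carrier_mat 1 1" "b' \<in> carrier_mat 1 n" "d' \<in> carrier_mat n n" for a b d a' b' d' :: "'a mat"
    using that by (subst mult_four_block_mat[of _ 1 1 _ n _ n]) auto
  have D_mult: "D A * D B = mat n n (\<lambda>(i, j). (Q * (A * B) * P) $$ (Suc i, Suc j))"
    if "A \<in> F" "B \<in> F" for A B
  proof -
    have "Q * (A * B) * P = (Q * A * P) * (Q * B * P)"
      using that Suc.prems(1) by (intro conj_mult) auto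
    also have "\<dots> = four_block_mat (E A * E B) (E A * R B + R A * D B) (0\<^sub>m n 1) (D A * D B)"
      unfolding block[OF that(1)] block[OF that(2)] by (intro block_mult DRE)
    finally show ?thesis by (intro eq_matI) (auto simp del: index_mult_mat(1) simp: E_def D_def)
  qed
  have "simultaneously_triangularizable n (D ` F)"
  proof (rule Suc.IH)
    show "D ` F \<subseteq> carrier_mat n n" "finite (D ` F)" using Suc.prems DRE by auto
    show "card (D ` F) \<le> k" using Suc.prems card_image_le[of F D] by simp
    show "commuting (D ` F)"
      using Suc.prems(4) D_mult by (auto simp: commuting_def)
  qed
  then obtain P' Q' where P': "P' \<in> carrier_mat n n" and Q': "Q' \<in> carrier_mat n n"
    and PQ': "P' * Q' = 1\<^sub>m n" "Q' * P' = 1\<^sub>m n"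
    and ut: "\<And>A. A \<in> F \<Longrightarrow> upper_triangular (Q' * D A * P')"
    unfolding simultaneously_triangularizable_def by auto
  define P1 where "P1 = four_block_mat (1\<^sub>m 1) (0\<^sub>m 1 n) (0\<^sub>m n 1) P'"
  define Q1 where "Q1 = four_block_mat (1\<^sub>m 1) (0\<^sub>m 1 n) (0\<^sub>m n 1) Q'"
  have C1: "P1 \<in> carrier_mat (Suc n) (Suc n)" "Q1 \<in> carrier_mat (Suc n) (Suc n)"
    using P' Q' by (auto simp: P1_def Q1_def)
  have PQ1: "P1 * Q1 = 1\<^sub>m (Suc n)" "Q1 * P1 = 1\<^sub>m (Suc n)"
  proof -
    show "P1 * Q1 = 1\<^sub>m (Suc n)"
      unfolding P1_def Q1_def using P' Q' PQ' four_block_one_mat[of 1 n]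
      by (subst block_mult) simp_all
    show "Q1 * P1 = 1\<^sub>m (Suc n)"
      unfolding P1_def Q1_def using P' Q' PQ' four_block_one_mat[of 1 n]
      by (subst block_mult) simp_all
  qed
  have inverse: "X * Y * (Z * U) = 1\<^sub>m (Suc n)"
    if "X \<in> carrier_mat (Suc n) (Suc n)" "Y \<in> carrier_mat (Suc n) (Suc n)"
      "Z \<in> carrier_mat (Suc n) (Suc n)" "U \<in> carrier_mat (Suc n) (Suc n)"
      "Y * Z = 1\<^sub>m (Suc n)" "X * U = 1\<^sub>m (Suc n)" for X Y Z U :: "'a mat"
  proof -
    have "X * Y * (Z * U) = X * (Y * Z) * U"
      using that(1-4) by (simp add: assoc_mult_mat[of _ "Suc n" "Suc n" _ "Suc n" _ "Suc n"])
    then show ?thesis using that by simp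
  qed
  have "upper_triangular (Q1 * Q * A * (P * P1))" if A: "A \<in> F" for A
  proof -
    have AC: "A \<in> carrier_mat (Suc n) (Suc n)" using A Suc.prems by auto
    have "Q1 * Q * A * (P * P1) = Q1 * (Q * A * P) * P1"
      using P Q C1 AC by (simp add: assoc_mult_mat[of _ "Suc n" "Suc n" _ "Suc n" _ "Suc n"])
    also have "\<dots> = four_block_mat (E A) (R A * P') (0\<^sub>m n 1) (Q' * D A * P')"
    proof -
      have "Q1 * (Q * A * P) = four_block_mat (E A) (R A) (0\<^sub>m n 1) (Q' * D A)"
        unfolding block[OF A] Q1_def using Q' DRE[of A] by (subst block_mult) auto
      moreover have "four_block_mat (E A) (R A) (0\<^sub>m n 1) (Q' * D A) * P1
          = four_block_mat (E A) (R A * P') (0\<^sub>m n 1) (Q' * D A * P')"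
        unfolding P1_def using Q' P' DRE[of A] by (subst block_mult) auto
      ultimately show ?thesis by simp
    qed
    finally have eq: "Q1 * Q * A * (P * P1) = four_block_mat (E A) (R A * P') (0\<^sub>m n 1) (Q' * D A * P')" .
    show ?thesis unfolding eq
      using ut[OF A] P' Q' DRE[of A] by (intro upper_triangular_four_block[of _ 1 _ n]) (auto simp: E_def)
  qed
  then show ?case
    unfolding simultaneously_triangularizable_def
    using P Q C1 PQ PQ1
    by (intro bexI[of _ "P * P1"] bexI[of _ "Q1 * Q"] conjI ballI inverse) auto
qed

text \<open>Write \<open>A\<close> in triangular form \<open>T\<close> and choose a nonzero \<open>u \<in> U\<close> whose coordinate vector
  \<open>x\<close> ends as early as possible, say at the coordinate \<open>s\<close>. With \<open>c\<close> the diagonal entry of \<open>T\<close> at \<open>s\<close>,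
  the coordinates of \<open>A u - c u\<close> end even earlier, so that this element of \<open>U\<close> is zero.\<close>

lemma eigenvector_in_invariant_set:
  fixes A :: "'a::field mat"
  assumes A: "A \<in> carrier_mat n n" and tri: "simultaneously_triangularizable n {A}"
    and U: "U \<subseteq> carrier_vec n" and closed: "\<And>u c. u \<in> U \<Longrightarrow> A *\<^sub>v u - c \<cdot>\<^sub>v u \<in> U"
    and nonzero: "w \<in> U" "w \<noteq> 0\<^sub>v n"
  obtains u c where "u \<in> U" "u \<noteq> 0\<^sub>v n" "A *\<^sub>v u = c \<cdot>\<^sub>v u"
proof -
  obtain P Q where P: "P \<in> carrier_mat n n" and Q: "Q \<in> carrier_mat n n"
    and PQ: "P * Q = 1\<^sub>m n" "Q * P = 1\<^sub>m n" and ut: "upper_triangular (Q * A * P)"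
    using tri unfolding simultaneously_triangularizable_def by auto
  define T where "T = Q * A * P"
  have T: "T \<in> carrier_mat n n" using P Q A by (simp add: T_def)
  \<comment> \<open>\<open>t\<close> is the least bound below which all nonzero coordinates of some nonzero
    \<open>u \<in> U\<close> lie; the last such coordinate is \<open>s = t - 1\<close>.\<close>
  define low where "low t u \<longleftrightarrow> u \<in> U \<and> u \<noteq> 0\<^sub>v n \<and> (\<forall>i\<in>{t..<n}. (Q *\<^sub>v u) $ i = 0)" for t u
  define t where "t = (LEAST t. \<exists>u. low t u)"
  have "low n w" using nonzero by (simp add: low_def)
  then have "\<exists>u. low t u" unfolding t_def by (intro LeastI[of "\<lambda>t. \<exists>u. low t u"]) auto
  then obtain u where u: "low t u" by blast
  have least: "\<not> low s u'" if "s < t" for s u'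
    using that not_less_Least unfolding t_def by blast
  have tn: "t \<le> n" unfolding t_def using \<open>low n w\<close> by (intro Least_le) auto
  have uC: "u \<in> carrier_vec n" using u U by (auto simp: low_def)
  have recover: "x = P *\<^sub>v (Q *\<^sub>v x)" if "x \<in> carrier_vec n" for x
    using that P Q PQ by (simp flip: assoc_mult_mat_vec[of _ n n _ n])
  have "t \<noteq> 0"
  proof
    assume "t = 0"
    then have "Q *\<^sub>v u = 0\<^sub>v n" using u Q by (intro eq_vecI) (auto simp: low_def)
    moreover have "P *\<^sub>v 0\<^sub>v n = 0\<^sub>v n" using P by (intro eq_vecI) auto
    ultimately have "u = 0\<^sub>v n" using recover[OF uC] by metis
    then show False using u by (simp add: low_def)
  qed
  then obtain s where s: "t = Suc s" by (cases t) auto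
  define x where "x = Q *\<^sub>v u"
  have x: "x \<in> carrier_vec n" using Q uC by (simp add: x_def)
  have x0: "x $ i = 0" if "s < i" "i < n" for i using u that by (auto simp: low_def x_def s)
  define c where "c = T $$ (s, s)"
  define u' where "u' = A *\<^sub>v u - c \<cdot>\<^sub>v u"
  have AuC: "A *\<^sub>v u \<in> carrier_vec n" using A uC by simp
  have "Q *\<^sub>v (A *\<^sub>v u) = Q *\<^sub>v (A *\<^sub>v (P *\<^sub>v x))" using recover[OF uC] by (simp add: x_def)
  also have "\<dots> = T *\<^sub>v x"
    using P Q A x by (simp add: T_def assoc_mult_mat_vec[of _ n n _ n])
  finally have Qu': "Q *\<^sub>v u' = T *\<^sub>v x - c \<cdot>\<^sub>v x"
    using Q uC AuC by (simp add: u'_def x_def mult_minus_distrib_mat_vec[of _ n n] mult_mat_vec[of _ n n])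
  have "(T *\<^sub>v x - c \<cdot>\<^sub>v x) $ i = 0" if i: "s \<le> i" "i < n" for i
  proof -
    have "(T *\<^sub>v x) $ i = (\<Sum>l\<in>{0..<n}. T $$ (i, l) * x $ l)"
      using T x i by (simp add: scalar_prod_def)
    also have "\<dots> = (\<Sum>l\<in>{i}. T $$ (i, l) * x $ l)"
    proof (rule sum.mono_neutral_right)
      show "\<forall>l\<in>{0..<n} - {i}. T $$ (i, l) * x $ l = 0"
      proof
        fix l assume l: "l \<in> {0..<n} - {i}"
        show "T $$ (i, l) * x $ l = 0"
        proof (cases "l < i")
          case True
          then show ?thesis using upper_triangularD[OF ut, of l i] i Q by (simp add: T_def)
        next
          case False
          then show ?thesis using x0[of l] l i by simp
        qed
      qed
    qed (use i in auto)
    finally show ?thesis using x0[of i] i x T by (cases "i = s") (auto simp: c_def)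
  qed
  then have "\<forall>i\<in>{s..<n}. (Q *\<^sub>v u') $ i = 0" by (simp add: Qu')
  moreover have "u' \<in> U" using closed u by (simp add: u'_def low_def)
  ultimately have "u' = 0\<^sub>v n" using least[of s u'] by (auto simp: low_def s)
  moreover have "y = z" if "y \<in> carrier_vec n" "z \<in> carrier_vec n" "y - z = 0\<^sub>v n" for y z :: "'a vec"
  proof (rule eq_vecI)
    show "y $ i = z $ i" if "i < dim_vec z" for i
      using arg_cong[OF \<open>y - z = 0\<^sub>v n\<close>, of "\<lambda>w. w $ i"] that \<open>y \<in> carrier_vec n\<close> \<open>z \<in> carrier_vec n\<close> by simp
  qed (use that in auto)
  ultimately have "A *\<^sub>v u = c \<cdot>\<^sub>v u" using AuC uC unfolding u'_def by simp
  then show ?thesis using that u by (auto simp: low_def)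
qed

lemma singleton_triangularizable:
  fixes A :: "'a::alg_closed_field mat"
  assumes "A \<in> carrier_mat n n"
  shows "simultaneously_triangularizable n {A}"
proof (rule triangularizable_if_common_eigenvectors[where k = 1])
  fix m :: nat and G :: "'a mat set"
  assume m: "m > 0" and G: "G \<subseteq> carrier_mat m m" "finite G" "card G \<le> 1"
  then consider "G = {}" | B where "G = {B}"
    by (metis One_nat_def card_0_eq card_1_singletonE le_Suc_eq le_zero_eq)
  then show "\<exists>v. common_eigenvector m G v"
  proof cases
    case 1
    then show ?thesis using m
      by (intro exI[of _ "unit_vec m 0"]) (auto simp: common_eigenvector_def)
  next
    case 2
    then show ?thesis using alg_closed_eigenvector_exists m G by auto
  qed
qed (use assms in \<open>auto simp: commuting_def\<close>)

text \<open>The matrices are treated one at a time: the joint eigenspace \<open>U\<close> of the earlier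
  ones is invariant under the next one, which therefore has an eigenvector in \<open>U\<close>.\<close>

lemma commuting_common_eigenvector_exists:
  fixes F :: "'a::alg_closed_field mat set"
  assumes "n > 0" "F \<subseteq> carrier_mat n n" "finite F" "commuting F"
  shows "\<exists>v. common_eigenvector n F v"
  using assms(3,2,4)
proof (induction F rule: finite_induct)
  case empty
  show ?case using \<open>n > 0\<close>
    by (intro exI[of _ "unit_vec n 0"]) (auto simp: common_eigenvector_def)
next
  case (insert A F)
  then obtain v where v: "common_eigenvector n F v" by (auto simp: commuting_def)
  then obtain c where c: "\<And>B. B \<in> F \<Longrightarrow> B *\<^sub>v v = c B \<cdot>\<^sub>v v"
    unfolding common_eigenvector_def by metis
  define U where "U = {u \<in> carrier_vec n. \<forall>B\<in>F. B *\<^sub>v u = c B \<cdot>\<^sub>v u}"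
  have A: "A \<in> carrier_mat n n" using insert.prems by simp
  have closed: "A *\<^sub>v u - d \<cdot>\<^sub>v u \<in> U" if "u \<in> U" for u d
  proof -
    have u: "u \<in> carrier_vec n" using that by (simp add: U_def)
    have "B *\<^sub>v (A *\<^sub>v u - d \<cdot>\<^sub>v u) = c B \<cdot>\<^sub>v (A *\<^sub>v u - d \<cdot>\<^sub>v u)" if BF: "B \<in> F" for B
    proof -
      have B: "B \<in> carrier_mat n n" using BF insert.prems by auto
      have Bu: "B *\<^sub>v u = c B \<cdot>\<^sub>v u" using BF \<open>u \<in> U\<close> by (simp add: U_def)
      have "B *\<^sub>v (A *\<^sub>v u) = (B * A) *\<^sub>v u" by (rule assoc_mult_mat_vec[OF B A u, symmetric])
      also have "B * A = A * B" using insert.prems(2) BF unfolding commuting_def by blast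
      also have "(A * B) *\<^sub>v u = A *\<^sub>v (B *\<^sub>v u)" by (rule assoc_mult_mat_vec[OF A B u])
      finally have "B *\<^sub>v (A *\<^sub>v u) = A *\<^sub>v (B *\<^sub>v u)" .
      then have BA: "B *\<^sub>v (A *\<^sub>v u) = c B \<cdot>\<^sub>v (A *\<^sub>v u)" using Bu A u by (simp add: mult_mat_vec[of _ n n])
      have "B *\<^sub>v (A *\<^sub>v u - d \<cdot>\<^sub>v u) = B *\<^sub>v (A *\<^sub>v u) - d \<cdot>\<^sub>v (B *\<^sub>v u)"
        using A B u by (simp add: mult_minus_distrib_mat_vec[of _ n n] mult_mat_vec[of _ n n])
      then show ?thesis using A u unfolding BA Bu by (intro eq_vecI) (auto simp: algebra_simps)
    qed
    then show ?thesis using A u by (auto simp: U_def)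
  qed
  have "v \<in> U" "v \<noteq> 0\<^sub>v n" using v c by (auto simp: U_def common_eigenvector_def)
  moreover have "U \<subseteq> carrier_vec n" by (auto simp: U_def)
  ultimately obtain u d where "u \<in> U" "u \<noteq> 0\<^sub>v n" "A *\<^sub>v u = d \<cdot>\<^sub>v u"
    using eigenvector_in_invariant_set[OF A singleton_triangularizable[OF A] _ closed] by metis
  then show ?case unfolding common_eigenvector_def U_def by blast
qed

theorem commuting_simultaneously_triangularizable:
  fixes F :: "'a::alg_closed_field mat set"
  assumes "F \<subseteq> carrier_mat n n" "finite F" "commuting F"
  shows "simultaneously_triangularizable n F"
  using commuting_common_eigenvector_exists assms
  by (intro triangularizable_if_common_eigenvectors[where k = "card F"]) auto

section \<open>The upper bound for commuting subspaces of gl(n)\<close>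

lemma conjugate_index_linear:
  fixes A B :: "'a::comm_ring_1 mat"
  assumes "P \<in> carrier_mat n n" "Q \<in> carrier_mat n n" "A \<in> carrier_mat n n" "B \<in> carrier_mat n n"
    and p: "p \<in> {..<n} \<times> {..<n}"
  shows "(Q * (A + B) * P) $$ p = (Q * A * P) $$ p + (Q * B * P) $$ p"
    and "(Q * (c \<cdot>\<^sub>m A) * P) $$ p = c * (Q * A * P) $$ p"
proof -
  have "Q * (A + B) * P = Q * A * P + Q * B * P"
    using assms(1-4)
    by (simp add: mult_add_distrib_mat[of _ n n _ n] add_mult_distrib_mat[of _ n n _ _ n])
  then show "(Q * (A + B) * P) $$ p = (Q * A * P) $$ p + (Q * B * P) $$ p"
    using assms by (cases p) simp
  have "Q * (c \<cdot>\<^sub>m A) * P = c \<cdot>\<^sub>m (Q * A * P)"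
    using assms(1-3)
    by (simp add: mult_smult_distrib[of _ n n _ n] mult_smult_assoc_mat[of _ n n _ n])
  then show "(Q * (c \<cdot>\<^sub>m A) * P) $$ p = c * (Q * A * P) $$ p"
    using assms by (cases p) simp
qed

lemma subspace_gl_fin_dim:
  assumes "VectorSpace.subspace class_ring S (gl (k :: 'a::field itself) n)"
  shows "vectorspace.fin_dim class_ring ((gl k n)\<lparr>carrier := S\<rparr>)"
proof (rule subspace_dim_le_card(1)[OF assms, where J = "{..<n} \<times> {..<n}" and \<phi> = "\<lambda>p A. A $$ p"])
  fix A assume "A \<in> S" and zero: "\<And>p. p \<in> {..<n} \<times> {..<n} \<Longrightarrow> A $$ p = 0"
  then have "A \<in> carrier_mat n n"
    using submodule.subset[OF VectorSpace.subspace.submod[OF assms]] by auto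
  then show "A = 0\<^sub>m n n" using zero by (intro eq_matI) auto
qed auto

text \<open>A finite generating set of \<open>S\<close> can be made triangular, and the matrices that become
  upper triangular under a given change of basis form a subspace.\<close>

lemma commuting_subspace_triangularizable:
  fixes k :: "'a::alg_closed_field itself"
  assumes S: "VectorSpace.subspace class_ring S (gl k n)" and comm: "commuting S"
  shows "simultaneously_triangularizable n S"
proof -
  interpret gl: vectorspace class_ring "gl k n" by (rule vectorspace_gl)
  interpret V: vectorspace class_ring "(gl k n)\<lparr>carrier := S\<rparr>" by (rule gl.subspace_is_vs[OF S])
  have subm: "submodule class_ring S (gl k n)" by (rule VectorSpace.subspace.submod[OF S])
  have sub: "S \<subseteq> carrier_mat n n" using submodule.subset[OF subm] by simp
  obtain F where F: "finite F" "F \<subseteq> S" and "V.span F = S"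
    using subspace_gl_fin_dim[OF S] unfolding V.fin_dim_def by auto
  then have span: "gl.span F = S" using gl.span_li_not_depend(1)[OF F(2) subm] by simp
  have "commuting F" using comm F(2) unfolding commuting_def by blast
  then have "simultaneously_triangularizable n F"
    using F sub by (intro commuting_simultaneously_triangularizable) auto
  then obtain P Q where P: "P \<in> carrier_mat n n" and Q: "Q \<in> carrier_mat n n"
    and PQ: "P * Q = 1\<^sub>m n" "Q * P = 1\<^sub>m n" and ut: "\<And>A. A \<in> F \<Longrightarrow> upper_triangular (Q * A * P)"
    unfolding simultaneously_triangularizable_def by blast
  let ?N = "{A \<in> carrier_mat n n. upper_triangular (Q * A * P)}"
  have "submodule class_ring ?N (gl k n)"
  proof (rule submodule.intro)
    show "Module.module class_ring (gl k n)" by (rule gl.module_axioms)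
    have C: "Q * A * P \<in> carrier_mat n n" if "A \<in> carrier_mat n n" for A
      using P Q that by simp
    show "\<zero>\<^bsub>gl k n\<^esub> \<in> ?N" using P Q by (auto intro!: upper_triangularI)
    show "A \<oplus>\<^bsub>gl k n\<^esub> B \<in> ?N" if "A \<in> ?N" "B \<in> ?N" for A B
    proof -
      have "upper_triangular (Q * (A + B) * P)"
      proof (rule upper_triangularI)
        fix i j assume ij: "j < i" "i < dim_row (Q * (A + B) * P)"
        then have "i < n" "j < n" using Q by auto
        then show "(Q * (A + B) * P) $$ (i, j) = 0"
          using that ij(1) C[of A] C[of B] upper_triangularD[of "Q * A * P" j i]
            upper_triangularD[of "Q * B * P" j i] Q
          by (subst conjugate_index_linear(1)[OF P Q]) auto
      qed
      then show ?thesis using that by simp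
    qed
    show "c \<odot>\<^bsub>gl k n\<^esub> A \<in> ?N" if "A \<in> ?N" for c A
    proof -
      have "upper_triangular (Q * (c \<cdot>\<^sub>m A) * P)"
      proof (rule upper_triangularI)
        fix i j assume ij: "j < i" "i < dim_row (Q * (c \<cdot>\<^sub>m A) * P)"
        then have "i < n" "j < n" using Q by auto
        then show "(Q * (c \<cdot>\<^sub>m A) * P) $$ (i, j) = 0"
          using that ij(1) C[of A] upper_triangularD[of "Q * A * P" j i] Q
          by (subst conjugate_index_linear(2)[OF P Q _ zero_carrier_mat]) auto
      qed
      then show ?thesis using that by simp
    qed
  qed simp_all
  moreover have "F \<subseteq> ?N" using F sub ut by auto
  ultimately have "S \<subseteq> ?N" using gl.span_is_subset span by blast
  then show ?thesis unfolding simultaneously_triangularizable_def using P Q PQ by blast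
qed

text \<open>Schur's bound: the functionals to which \<open>subspace_dim_le_card\<close> is applied
  are the entries of the triangularized matrix at the determining positions.\<close>

theorem commuting_subspace_dim_le:
  fixes k :: "'a::alg_closed_field itself"
  assumes S: "VectorSpace.subspace class_ring S (gl k n)" and comm: "commuting S"
  shows "subspace_dim class_ring S (gl k n) \<le> n\<^sup>2 div 4 + 1"
proof -
  have sub: "S \<subseteq> carrier_mat n n"
    using submodule.subset[OF VectorSpace.subspace.submod[OF S]] by simp
  obtain P Q where P: "P \<in> carrier_mat n n" and Q: "Q \<in> carrier_mat n n"
    and PQ: "P * Q = 1\<^sub>m n" "Q * P = 1\<^sub>m n" and ut: "\<And>A. A \<in> S \<Longrightarrow> upper_triangular (Q * A * P)"
    using commuting_subspace_triangularizable[OF S comm]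
    unfolding simultaneously_triangularizable_def by blast
  let ?W = "(\<lambda>A. Q * A * P) ` S"
  have assoc: "X * Y * Z = X * (Y * Z)"
    if "X \<in> carrier_mat n n" "Y \<in> carrier_mat n n" "Z \<in> carrier_mat n n" for X Y Z :: "'a mat"
    using that by (rule assoc_mult_mat)
  have mult: "(Q * A * P) * (Q * B * P) = Q * (A * B) * P" if "A \<in> S" "B \<in> S" for A B
  proof -
    have AB: "A \<in> carrier_mat n n" "B \<in> carrier_mat n n" using that sub by auto
    have "(Q * A * P) * (Q * B * P) = Q * A * (P * Q) * (B * P)"
      using P Q AB by (simp add: assoc)
    then show ?thesis using P Q AB PQ by (simp add: assoc)
  qed
  have "commuting ?W"
    using comm mult unfolding commuting_def by simp
  moreover have "?W \<subseteq> carrier_mat n n" using P Q sub by auto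
  moreover have "upper_triangular B" if "B \<in> ?W" for B using that ut by blast
  ultimately have "\<exists>J \<subseteq> {0..<0 + n} \<times> {0..<0 + n}. card J \<le> n\<^sup>2 div 4 + 1 \<and>
      (\<forall>B\<in>?W. (\<forall>p\<in>J. B $$ p = 0) \<longrightarrow> vanishes_on_block 0 (0 + n) B)"
    by (intro commuting_upper_tri_determined[where n = n]) simp_all
  then obtain J where J: "J \<subseteq> {0..<n} \<times> {0..<n}" "card J \<le> n\<^sup>2 div 4 + 1"
    and det: "\<And>A. A \<in> S \<Longrightarrow> \<forall>p\<in>J. (Q * A * P) $$ p = 0 \<Longrightarrow> vanishes_on_block 0 n (Q * A * P)"
    by auto
  have Jn: "p \<in> {..<n} \<times> {..<n}" if "p \<in> J" for p using J(1) that by auto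
  have "subspace_dim class_ring S (gl k n) \<le> card J"
  proof (rule subspace_dim_le_card(2)[OF S, where \<phi> = "\<lambda>p A. (Q * A * P) $$ p"])
    show "finite J" using J(1) finite_subset by blast
  next
    fix A assume A: "A \<in> S" and "\<And>p. p \<in> J \<Longrightarrow> (Q * A * P) $$ p = 0"
    then have "vanishes_on_block 0 n (Q * A * P)" using det by blast
    then have "Q * A * P = 0\<^sub>m n n"
      using P Q by (intro eq_matI) (auto simp: vanishes_on_block_def simp del: index_mult_mat(1))
    then have "P * (Q * A * P) * Q = 0\<^sub>m n n" using P Q by simp
    moreover have AC: "A \<in> carrier_mat n n" using A sub by blast
    moreover have "P * (Q * A * P) * Q = (P * Q) * A * (P * Q)"
      using P Q AC by (simp add: assoc mult_carrier_mat[of _ n n])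
    ultimately show "A = 0\<^sub>m n n" using PQ by simp
  qed (use Jn conjugate_index_linear[OF P Q] in auto)
  then show ?thesis using J(2) by simp
qed

section \<open>The scalar matrices plus the corner block\<close>

lemma corner_block_eq:
  "corner_block (k :: 'a::field itself) n = {A \<in> carrier_mat n n.
     \<forall>i<n. \<forall>j<n. n div 2 \<le> i \<or> j < n div 2 \<longrightarrow> A $$ (i, j) = 0}" (is "_ = ?R")
proof
  interpret gl: vectorspace class_ring "gl k n" by (rule vectorspace_gl)
  define G where "G = {matrix_unit n i j :: 'a mat | i j. i < n div 2 \<and> n div 2 \<le> j \<and> j < n}"
  have corner: "corner_block k n = gl.span G" by (simp add: corner_block_def G_def)
  have GC: "G \<subseteq> carrier (gl k n)" by (auto simp: G_def matrix_unit_def)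
  have span: "submodule class_ring (gl.span G) (gl k n)" by (rule gl.span_is_submodule[OF GC])
  have "submodule class_ring ?R (gl k n)"
    by (rule submodule.intro) (auto intro: gl.module_axioms)
  moreover have "G \<subseteq> ?R" by (auto simp: G_def matrix_unit_def split: if_splits)
  ultimately show "corner_block k n \<subseteq> ?R" unfolding corner by (intro gl.span_is_subset)
  show "?R \<subseteq> corner_block k n"
  proof
    fix A assume A: "A \<in> ?R"
    have "mat n n (\<lambda>p. if p \<in> X then A $$ p else 0) \<in> gl.span G"
      if "finite X" "X \<subseteq> {..<n div 2} \<times> {n div 2..<n}" for X
      using that
    proof (induction X rule: finite_induct)
      case empty
      have "mat n n (\<lambda>p. if p \<in> {} then A $$ p else 0) = 0\<^sub>m n n" by (intro eq_matI) auto
      then show ?case using submodule.zero_closed[OF span] by simp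
    next
      case (insert p X)
      obtain i j where p: "p = (i, j)" "i < n div 2" "n div 2 \<le> j" "j < n"
        using insert.prems by (cases p) auto
      have "mat n n (\<lambda>p'. if p' \<in> insert p X then A $$ p' else 0) =
          A $$ p \<cdot>\<^sub>m matrix_unit n i j + mat n n (\<lambda>p'. if p' \<in> X then A $$ p' else 0)"
        using insert.hyps p(1) by (intro eq_matI) (auto simp: matrix_unit_def)
      moreover have "matrix_unit n i j \<in> gl.span G"
        using gl.in_own_span[OF GC] p by (auto simp: G_def)
      ultimately show ?case
        using submodule.m_closed[OF span submodule.smult_closed[OF span]] insert by simp
    qed
    from this[of "{..<n div 2} \<times> {n div 2..<n}"]
    have "mat n n (\<lambda>p. if p \<in> {..<n div 2} \<times> {n div 2..<n} then A $$ p else 0) \<in> gl.span G"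
      by simp
    moreover have "mat n n (\<lambda>p. if p \<in> {..<n div 2} \<times> {n div 2..<n} then A $$ p else 0) = A"
      using A by (intro eq_matI) auto
    ultimately show "A \<in> corner_block k n" by (simp add: corner)
  qed
qed

lemma scalar_corner_sum_eq:
  "LinearCombinations.module.submodule_sum (gl (k :: 'a::field itself) n)
     (scalar_matrices k n) (corner_block k n) =
   {c \<cdot>\<^sub>m 1\<^sub>m n + B | c B. B \<in> corner_block k n}"
proof -
  interpret gl: vectorspace class_ring "gl k n" by (rule vectorspace_gl)
  show ?thesis unfolding gl.submodule_sum_def by (auto simp: scalar_matrices_def)
qed

lemma scalar_inter_corner_block:
  assumes "n > 0"
  shows "scalar_matrices k n \<inter> corner_block (k :: 'a::field itself) n = {0\<^sub>m n n}"
proof (intro equalityI subsetI)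
  fix A :: "'a mat" assume A_mem: "A \<in> scalar_matrices k n \<inter> corner_block k n"
  then obtain c where A: "A = c \<cdot>\<^sub>m 1\<^sub>m n" unfolding scalar_matrices_def by blast
  have "A $$ (0, 0) = 0"
    using A_mem assms unfolding corner_block_eq by (cases "n div 2 = 0") auto
  then have "c = 0" using assms by (simp add: A)
  then show "A \<in> {0\<^sub>m n n}" unfolding A by (auto intro!: eq_matI)
next
  fix A :: "'a mat" assume "A \<in> {0\<^sub>m n n}"
  then have "A = 0 \<cdot>\<^sub>m 1\<^sub>m n" by (auto intro!: eq_matI)
  then show "A \<in> scalar_matrices k n \<inter> corner_block k n"
    by (auto simp: scalar_matrices_def corner_block_eq)
qed

text \<open>The columns in which the left factor can be nonzero are rows in which the right factor is
  zero.\<close>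

lemma corner_block_mult_zero:
  fixes k :: "'a::field itself"
  assumes "B \<in> corner_block k n" "C \<in> corner_block k n"
  shows "B * C = 0\<^sub>m n n"
proof (rule eq_matI)
  fix i j assume "i < dim_row (0\<^sub>m n n)" "j < dim_col (0\<^sub>m n n)"
  then have ij: "i < n" "j < n" by auto
  have B0: "\<And>l. l < n \<Longrightarrow> l < n div 2 \<Longrightarrow> B $$ (i, l) = 0"
    and C0: "\<And>l. l < n \<Longrightarrow> n div 2 \<le> l \<Longrightarrow> C $$ (l, j) = 0"
    using assms ij by (simp_all add: corner_block_eq)
  have "B $$ (i, l) * C $$ (l, j) = 0" if "l < n" for l
    using B0[OF that] C0[OF that] by (cases "l < n div 2") simp_all
  then have "(\<Sum>l\<in>{0..<n}. B $$ (i, l) * C $$ (l, j)) = 0" by (intro sum.neutral) simp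
  moreover have "B \<in> carrier_mat n n" "C \<in> carrier_mat n n"
    using assms unfolding corner_block_eq by blast+
  ultimately show "(B * C) $$ (i, j) = 0\<^sub>m n n $$ (i, j)"
    using ij by (simp add: scalar_prod_def)
qed (use assms in \<open>auto simp: corner_block_eq\<close>)

lemma corner_block_linear_closed:
  assumes "B \<in> corner_block (k :: 'a::field itself) n" "C \<in> corner_block k n"
  shows "B + C \<in> corner_block k n" "c \<cdot>\<^sub>m B \<in> corner_block k n"
  using assms by (auto simp: corner_block_eq)

context
  fixes k :: "'a::field itself" and n :: nat and A :: "'a mat set"
  defines "A \<equiv> {c \<cdot>\<^sub>m 1\<^sub>m n + B | c B. B \<in> corner_block k n}"
begin

lemma scalar_corner_sum_commuting: "commuting A"
  unfolding commuting_def
proof (intro ballI)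
  fix X Y assume "X \<in> A" "Y \<in> A"
  then obtain c B d C where X: "X = c \<cdot>\<^sub>m 1\<^sub>m n + B" "B \<in> corner_block k n"
    and Y: "Y = d \<cdot>\<^sub>m 1\<^sub>m n + C" "C \<in> corner_block k n"
    by (auto simp: A_def)
  have BC: "B \<in> carrier_mat n n" "C \<in> carrier_mat n n" using X Y by (auto simp: corner_block_eq)
  have expand: "(c \<cdot>\<^sub>m 1\<^sub>m n + B) * (d \<cdot>\<^sub>m 1\<^sub>m n + C) = c \<cdot>\<^sub>m (d \<cdot>\<^sub>m 1\<^sub>m n + C) + (d \<cdot>\<^sub>m B + B * C)"
    if "B \<in> carrier_mat n n" "C \<in> carrier_mat n n" for c d and B C :: "'a mat"
  proof -
    have "B * (d \<cdot>\<^sub>m 1\<^sub>m n + C) = d \<cdot>\<^sub>m B + B * C"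
      using that mult_add_distrib_mat[of B n n "d \<cdot>\<^sub>m 1\<^sub>m n" n C]
      by (simp add: mult_smult_distrib[of _ n n _ n])
    then show ?thesis
      using that by (simp add: add_mult_distrib_mat[of _ n n _ _ n] mult_smult_assoc_mat[of _ n n _ n])
  qed
  show "X * Y = Y * X"
    unfolding X(1) Y(1) expand[OF BC] expand[OF BC(2,1)]
      corner_block_mult_zero[OF X(2) Y(2)] corner_block_mult_zero[OF Y(2) X(2)]
    using BC by (intro eq_matI) (auto simp: algebra_simps)
qed

lemma scalar_corner_sum_subset: "A \<subseteq> {X \<in> carrier_mat n n. upper_triangular X}"
proof
  fix X assume "X \<in> A"
  then obtain c B where X: "X = c \<cdot>\<^sub>m 1\<^sub>m n + B" and B: "B \<in> carrier_mat n n"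
    "\<And>i j. i < n \<Longrightarrow> j < n \<Longrightarrow> n div 2 \<le> i \<or> j < n div 2 \<Longrightarrow> B $$ (i, j) = 0"
    by (auto simp: A_def corner_block_eq)
  have "upper_triangular X"
  proof (rule upper_triangularI)
    fix i j assume "j < i" "i < dim_row X"
    then have ij: "j < i" "i < n" "j < n" using X B(1) by auto
    then have "B $$ (i, j) = 0" using B(2)[of i j] by linarith
    then show "X $$ (i, j) = 0" using ij B(1) by (simp add: X)
  qed
  then show "X \<in> {X \<in> carrier_mat n n. upper_triangular X}" using B(1) by (simp add: X)
qed

lemma scalar_corner_sum_subspace: "VectorSpace.subspace class_ring A (gl k n)"
proof (rule VectorSpace.subspace.intro[OF vectorspace_gl], rule submodule.intro)
  show "Module.module class_ring (gl k n)" by (rule vectorspace.axioms(1)[OF vectorspace_gl])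
  show "A \<subseteq> carrier (gl k n)" using scalar_corner_sum_subset by auto
  have "0\<^sub>m n n \<in> corner_block k n" by (auto simp: corner_block_eq)
  moreover have "0\<^sub>m n n = 0 \<cdot>\<^sub>m 1\<^sub>m n + (0\<^sub>m n n :: 'a mat)" by (intro eq_matI) auto
  ultimately show "\<zero>\<^bsub>gl k n\<^esub> \<in> A" unfolding A_def gl_simps by blast
next
  fix X Y assume "X \<in> A" "Y \<in> A"
  then obtain c B d C where X: "X = c \<cdot>\<^sub>m 1\<^sub>m n + B" "B \<in> corner_block k n"
    and Y: "Y = d \<cdot>\<^sub>m 1\<^sub>m n + C" "C \<in> corner_block k n"
    by (auto simp: A_def)
  have "X + Y = (c + d) \<cdot>\<^sub>m 1\<^sub>m n + (B + C)"
    using X Y by (intro eq_matI) (auto simp: corner_block_eq algebra_simps)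
  then show "X \<oplus>\<^bsub>gl k n\<^esub> Y \<in> A"
    using corner_block_linear_closed(1)[OF X(2) Y(2)] unfolding A_def gl_simps by blast
next
  fix e X assume "X \<in> A"
  then obtain c B where X: "X = c \<cdot>\<^sub>m 1\<^sub>m n + B" "B \<in> corner_block k n" by (auto simp: A_def)
  have "e \<cdot>\<^sub>m X = (e * c) \<cdot>\<^sub>m 1\<^sub>m n + e \<cdot>\<^sub>m B"
    using X by (intro eq_matI) (auto simp: corner_block_eq algebra_simps)
  then show "e \<odot>\<^bsub>gl k n\<^esub> X \<in> A"
    using corner_block_linear_closed(2)[OF X(2) X(2)] unfolding A_def gl_simps by blast
qed

text \<open>The parameters of \<open>kI + P\<close> are put into one vector: coordinate \<open>0\<close> holds the scalar, and the
  coordinates from \<open>1\<close> on hold the \<open>q \<times> r\<close> corner block row by row. This gives an injective linear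
  map from vectors of length \<open>1 + q r\<close> into \<open>kI + P\<close>.\<close>

lemma scalar_corner_sum_dim_ge:
  assumes "n > 0"
  shows "n\<^sup>2 div 4 + 1 \<le> subspace_dim class_ring A (gl k n)"
proof -
  define q where "q = n div 2"
  define r where "r = n - q"
  have qn: "q < n" "q + r = n" "r > 0" using assms by (auto simp: q_def r_def)
  define N where "N = Suc (q * r)"
  have N: "N = n\<^sup>2 div 4 + 1"
  proof (cases "even n")
    case True
    then obtain l where "n = 2 * l" by auto
    then show ?thesis by (simp add: N_def q_def r_def power2_eq_square)
  next
    case False
    then obtain l where l: "n = 2 * l + 1" by (auto elim: oddE)
    then have "q = l" "r = l + 1" "n\<^sup>2 = 4 * (l * (l + 1)) + 1"
      by (auto simp: q_def r_def power2_eq_square algebra_simps)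
    then show ?thesis by (simp add: N_def)
  qed
  define B where "B v = mat n n (\<lambda>(i, j). if i < q \<and> q \<le> j then v $ Suc (i * r + (j - q)) else 0)"
    for v :: "'a vec"
  define T where "T v = (v $ 0) \<cdot>\<^sub>m 1\<^sub>m n + B v" for v
  have pos: "Suc (i * r + (j - q)) < N" if "i < q" "q \<le> j" "j < n" for i j
  proof -
    have "i * r + (j - q) < i * r + r" using that qn by auto
    also have "\<dots> = Suc i * r" by simp
    also have "\<dots> \<le> q * r" using that by (intro mult_le_mono1) simp
    finally show ?thesis by (simp add: N_def)
  qed
  let ?V = "module_vec TYPE('a) N"
  let ?W = "(gl k n)\<lparr>carrier := A\<rparr>"
  interpret gl: vectorspace class_ring "gl k n" by (rule vectorspace_gl)
  interpret V: vectorspace class_ring ?V by (rule vec_vs)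
  interpret W: vectorspace class_ring ?W by (rule gl.subspace_is_vs[OF scalar_corner_sum_subspace])
  have TA: "T v \<in> A" for v
  proof -
    have "B v \<in> corner_block k n" by (auto simp: B_def corner_block_eq q_def split: if_splits)
    then show ?thesis unfolding A_def T_def by blast
  qed
  have "T (v + w) = T v + T w" if "v \<in> carrier_vec N" "w \<in> carrier_vec N" for v w
    using that pos by (intro eq_matI) (auto simp: T_def B_def N_def)
  moreover have "T (c \<cdot>\<^sub>v v) = c \<cdot>\<^sub>m T v" if "v \<in> carrier_vec N" for c v
    using that pos by (intro eq_matI) (auto simp: T_def B_def N_def algebra_simps)
  ultimately have "T \<in> LinearCombinations.module_hom class_ring ?V ?W"
    unfolding LinearCombinations.module_hom_def using TA by (simp add: module_vec_simps)
  then interpret T: linear_map class_ring ?V ?W T by unfold_locales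
  have inj: "inj_on T (carrier ?V)"
  proof (rule inj_onI)
    fix v w assume "v \<in> carrier ?V" "w \<in> carrier ?V" and eq: "T v = T w"
    then have v: "v \<in> carrier_vec N" and w: "w \<in> carrier_vec N" by (simp_all add: module_vec_simps)
    \<comment> \<open>The last diagonal position lies outside the corner block, as \<open>q \<le> n - 1\<close>.\<close>
    have T0: "T x $$ (n - 1, n - 1) = x $ 0" for x
      using qn by (auto simp: T_def B_def)
    show "v = w"
    proof (rule eq_vecI)
      fix l assume "l < dim_vec w"
      then have l: "l < N" using w by simp
      show "v $ l = w $ l"
      proof (cases l)
        case 0
        then show ?thesis using T0[of v] T0[of w] eq by simp
      next
        case (Suc l')
        then have "l' < q * r" using l by (simp add: N_def)
        then have i: "l' div r < q" by (simp add: less_mult_imp_div_less)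
        have j: "q + l' mod r < n" using qn by (metis add_less_cancel_left mod_less_divisor)
        have "T x $$ (l' div r, q + l' mod r) = x $ l" for x
          using i j qn Suc by (simp add: T_def B_def)
        then show ?thesis using eq by metis
      qed
    qed (use v w in simp)
  qed
  have fin: "W.fin_dim" by (rule subspace_gl_fin_dim[OF scalar_corner_sum_subspace])
  show ?thesis
    using T.inj_imp_dim_le(2)[OF inj fin]
    by (simp add: subspace_dim_def vec_space.dim_is_n N)
qed

end

section \<open>Abelian subalgebras of maximum dimension\<close>

lemma abelian_subalgebra_upper_tri_imp_gl:
  assumes "abelian_subalgebra class_ring S (upper_tri k n)"
  shows "abelian_subalgebra class_ring S (gl k n)"
proof -
  have "submodule class_ring S (upper_tri k n)"
    using assms unfolding abelian_subalgebra_def lie_subalgebra_def VectorSpace.subspace_def by simp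
  then have "submodule class_ring S (gl k n)"
    using vectorspace.axioms(1)[OF vectorspace_gl[of k n]]
    unfolding submodule_def by auto
  moreover from this have "0\<^sub>m n n \<in> S" using submodule.zero_closed by fastforce
  ultimately show ?thesis
    using assms vectorspace_gl[of k n]
    unfolding abelian_subalgebra_def lie_subalgebra_def VectorSpace.subspace_def by simp
qed

lemma abelian_subalgebra_gl_commuting:
  assumes "abelian_subalgebra class_ring S (gl (k :: 'a::field itself) n)"
  shows "VectorSpace.subspace class_ring S (gl k n)" and "commuting S"
proof -
  show sub: "VectorSpace.subspace class_ring S (gl k n)"
    using assms unfolding abelian_subalgebra_def lie_subalgebra_def by simp
  have S: "S \<subseteq> carrier_mat n n"
    using submodule.subset[OF VectorSpace.subspace.submod[OF sub]] by simp
  show "commuting S" unfolding commuting_def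
  proof (intro ballI)
    fix A B assume AB: "A \<in> S" "B \<in> S"
    then have C: "A * B \<in> carrier_mat n n" "B * A \<in> carrier_mat n n"
      using S by (meson mult_carrier_mat subsetD)+
    have zero: "A * B - B * A = 0\<^sub>m n n"
      using assms AB by (simp add: abelian_subalgebra_def)
    show "A * B = B * A"
    proof (rule eq_matI)
      fix i j assume ij: "i < dim_row (B * A)" "j < dim_col (B * A)"
      then have "i < n" "j < n" using carrier_matD[OF C(2)] by (metis+)
      then show "(A * B) $$ (i, j) = (B * A) $$ (i, j)"
        using arg_cong[OF zero, of "\<lambda>X. X $$ (i, j)"]
        unfolding index_minus_mat(1)[OF ij] by simp
    qed (metis C carrier_matD)+
  qed
qed

lemma commuting_imp_abelian_subalgebra_upper_tri:
  assumes sub: "VectorSpace.subspace class_ring S (gl (k :: 'a::field itself) n)"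
    and ut: "S \<subseteq> {X \<in> carrier_mat n n. upper_triangular X}" and comm: "commuting S"
  shows "abelian_subalgebra class_ring S (upper_tri k n)"
proof -
  have "submodule class_ring S (upper_tri k n)"
    using VectorSpace.subspace.submod[OF sub] ut
      vectorspace.axioms(1)[OF vectorspace_upper_tri[of k n]]
    unfolding submodule_def by simp
  moreover have "0\<^sub>m n n \<in> S"
    using submodule.zero_closed[OF VectorSpace.subspace.submod[OF sub]] by simp
  moreover have "A * B - B * A = 0\<^sub>m n n" if "A \<in> S" "B \<in> S" for A B
  proof -
    have "A \<in> carrier_mat n n" "B \<in> carrier_mat n n" using that ut by blast+
    then have "B * A \<in> carrier_mat n n" by simp
    moreover have "A * B = B * A" using that comm unfolding commuting_def by blast
    ultimately show ?thesis by simp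
  qed
  ultimately show ?thesis
    using vectorspace_upper_tri[of k n]
    unfolding abelian_subalgebra_def lie_subalgebra_def VectorSpace.subspace_def by simp
qed

lemma alpha_eq_subspace_dim:
  assumes "max_dim_abelian_subalgebra K A L"
  shows "alpha K L = subspace_dim K A L"
  unfolding alpha_def
proof (rule Max_eqI)
  show "finite {subspace_dim K S L | S. abelian_subalgebra K S L}"
    using assms by (intro finite_subset[OF _ finite_atMost[of "subspace_dim K A L"]])
      (auto simp: max_dim_abelian_subalgebra_def)
qed (use assms in \<open>auto simp: max_dim_abelian_subalgebra_def\<close>)

theorem corollary6p10:
  fixes k :: "'a::{alg_closed_field, field_char_0} itself" and n :: nat
  assumes "n > 0"
  shows "alpha class_ring (upper_tri k n) = n\<^sup>2 div 4 + 1 \<and>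
    alpha class_ring (gl k n) = n\<^sup>2 div 4 + 1 \<and>
    scalar_matrices k n \<inter> corner_block k n = {0\<^sub>m n n} \<and>
    max_dim_abelian_subalgebra class_ring
      (LinearCombinations.module.submodule_sum (gl k n) (scalar_matrices k n) (corner_block k n))
      (upper_tri k n) \<and>
    max_dim_abelian_subalgebra class_ring
      (LinearCombinations.module.submodule_sum (gl k n) (scalar_matrices k n) (corner_block k n))
      (gl k n)"
proof -
  define A where "A = LinearCombinations.module.submodule_sum (gl k n)
    (scalar_matrices k n) (corner_block k n)"
  note A_eq = A_def[unfolded scalar_corner_sum_eq]
  have A_ut: "abelian_subalgebra class_ring A (upper_tri k n)"
    unfolding A_eq
    by (intro commuting_imp_abelian_subalgebra_upper_tri scalar_corner_sum_subspace
        scalar_corner_sum_subset scalar_corner_sum_commuting)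
  then have A_gl: "abelian_subalgebra class_ring A (gl k n)"
    by (rule abelian_subalgebra_upper_tri_imp_gl)
  have dim_upper_tri: "subspace_dim class_ring S (upper_tri k n) = subspace_dim class_ring S (gl k n)" for S
    by (simp add: subspace_dim_def upper_tri_def)
  have bound: "subspace_dim class_ring S (gl k n) \<le> n\<^sup>2 div 4 + 1"
    if "abelian_subalgebra class_ring S (gl k n)" for S
    using commuting_subspace_dim_le abelian_subalgebra_gl_commuting[OF that] by blast
  have dim_A: "subspace_dim class_ring A (gl k n) = n\<^sup>2 div 4 + 1"
    using bound[OF A_gl] scalar_corner_sum_dim_ge[OF assms, of k] unfolding A_eq by (rule antisym)
  have max_gl: "max_dim_abelian_subalgebra class_ring A (gl k n)"
    using A_gl bound dim_A by (simp add: max_dim_abelian_subalgebra_def)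
  have max_ut: "max_dim_abelian_subalgebra class_ring A (upper_tri k n)"
    using A_ut dim_A bound[OF abelian_subalgebra_upper_tri_imp_gl]
    by (simp add: max_dim_abelian_subalgebra_def dim_upper_tri)
  show ?thesis
    using alpha_eq_subspace_dim[OF max_gl] alpha_eq_subspace_dim[OF max_ut] dim_A
      scalar_inter_corner_block[OF assms, of k] max_gl max_ut
    by (simp add: dim_upper_tri A_def)
qed

end
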